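(* Let $v,k,\lambda,n$ be integers with $n\ge 2$. If a $(v,k,\lambda)$ projection $n$-cube with $k\ge 2$ exists, then $$n\le \frac{v(v+1)}{2}.$$
   Context: A symmetric $(v,k,\lambda)$ design is identified with its incidence matrix: it is a $v\times v$ matrix $A$ with entries in $\{0,1\}$ satisfying $A A^t=(k-\lambda)I+\lambda J$, where $I$ is the identity matrix and $J$ the all-ones matrix; as in the usual definition of symmetric block designs, every column of $A$ also contains exactly $k$ ones (this is automatic when $\lambda<k$). Let $\mathbb{F}$ be a field of characteristic $0$. An $n$-dimensional matrix of order $v$ over $\mathbb{F}$ ($n\ge 2$) is a function $C:\{1,\ldots,v\}^n\to\mathbb{F}$. For $1\le x<y\le n$, the projection $\Pi_{xy}(C)$ is the $v\times v$ matrix whose $(i_x,i_y)$-entry is the sum (in $\mathbb{F}$) of $C(i_1,\ldots,i_n)$ over all $n$-tuples $(i_1,\ldots,i_n)\in\{1,\ldots,v\}^n$ with the coordinates $i_x$ and $i_y$ fixed. A $(v,k,\lambda)$ projection $n$-cube is an $n$-dimensional matrix $C:\{1,\ldots,v\}^n\to\mathbb{F}$ with entries in $\{0,1\}$ such that all projections $\Pi_{xy}(C)$, $1\le x<y\le n$, are symmetric $(v,k,\lambda)$ designs. *)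

theory Defs
  imports Complex_Main "HOL-Library.FuncSet" "Jordan_Normal_Form.Matrix"
begin

text \<open>All indices are zero-based, as for the matrices of \<^theory>\<open>Jordan_Normal_Form.Matrix\<close>:
  coordinates range over \<open>{..<n}\<close> and points and blocks over \<open>{..<v}\<close>.\<close>

text \<open>The parameters are integers, so that \<open>k - l\<close> is not truncated. The number of ones
  in the columns is a separate requirement because for \<open>k = l\<close> the matrix
  equation does not imply it.\<close>

definition symmetric_design :: "nat \<Rightarrow> int \<Rightarrow> int \<Rightarrow> 'a::field_char_0 mat \<Rightarrow> bool" where
  "symmetric_design v k l A \<longleftrightarrow>
     A \<in> carrier_mat v v \<and>
     elements_mat A \<subseteq> {0, 1} \<and>
     A * transpose_mat A = of_int (k - l) \<cdot>\<^sub>m 1\<^sub>m v + of_int l \<cdot>\<^sub>m mat v v (\<lambda>_. 1) \<and>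
     (\<forall>j<v. int (card {i. i < v \<and> A $$ (i, j) = 1}) = k)"

definition index_tuples :: "nat \<Rightarrow> nat \<Rightarrow> (nat \<Rightarrow> nat) set" where
  "index_tuples v n = {..<n} \<rightarrow>\<^sub>E {..<v}"

text \<open>An \<open>n\<close>-dimensional matrix of order \<open>v\<close> is represented by a function on index
  tuples, of which only the values on \<^term>\<open>index_tuples v n\<close> matter.\<close>

definition projection ::
    "nat \<Rightarrow> nat \<Rightarrow> nat \<Rightarrow> nat \<Rightarrow> ((nat \<Rightarrow> nat) \<Rightarrow> 'a::field_char_0) \<Rightarrow> 'a mat" where
  "projection v n x y C =
     mat v v (\<lambda>(a, b). \<Sum>i \<in> {i \<in> index_tuples v n. i x = a \<and> i y = b}. C i)"

definition projection_cube ::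
    "nat \<Rightarrow> int \<Rightarrow> int \<Rightarrow> nat \<Rightarrow> ((nat \<Rightarrow> nat) \<Rightarrow> 'a::field_char_0) \<Rightarrow> bool" where
  "projection_cube v k l n C \<longleftrightarrow>
     (\<forall>i \<in> index_tuples v n. C i \<in> {0, 1}) \<and>
     (\<forall>x y. x < y \<and> y < n \<longrightarrow> symmetric_design v k l (projection v n x y C))"

end

theory Submission
  imports Defs
begin

text \<open>
  Read the support \<open>S\<close> of a projection cube as a set of words of length \<open>n\<close> over an alphabet
  of \<open>v\<close> letters. The matrices \<open>\<Pi>\<^sub>x\<^sub>y\<close> have entries in \<open>{0, 1}\<close>, and such an entry counts the
  words that have two prescribed letters in positions \<open>x\<close> and \<open>y\<close>; hence two different words
  agree in at most one position (\<open>support_agree_once\<close>). Since rows and columns of a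
  symmetric design have sum \<open>k\<close>, every letter occurs in every position of exactly \<open>k\<close> words
  (\<open>card_support_letter\<close>), so \<open>\<bar>S\<bar> = v k\<close>.

  Now fix a word \<open>w\<close>. For each of the \<open>n\<close> positions there are \<open>k - 1\<close> other words that agree
  with \<open>w\<close> there, and no word is found for two positions. Therefore
  \<open>n (k - 1) \<le> v k - 1\<close> (\<open>words_agreeing_once_bound\<close>). For \<open>k \<ge> 2\<close> this gives
  \<open>n \<le> v + (v - 1) / (k - 1) \<le> 2 v - 1\<close>, which is at most \<open>v (v + 1) / 2\<close> because the
  difference is \<open>(v - 1) (v - 2) / 2 \<ge> 0\<close>.
\<close>

lemma words_agreeing_once_bound:
  fixes S :: "(nat \<Rightarrow> nat) set"
  assumes fin: "finite S" and "w \<in> S" and "n \<ge> 1"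
    and letters: "\<And>i x. i \<in> S \<Longrightarrow> x < n \<Longrightarrow> i x < v"
    and balanced: "\<And>x a. x < n \<Longrightarrow> a < v \<Longrightarrow> card {i \<in> S. i x = a} = k"
    and agree: "\<And>i j x y. \<lbrakk>i \<in> S; j \<in> S; x < y; y < n; i x = j x; i y = j y\<rbrakk> \<Longrightarrow> i = j"
  shows "n * (k - 1) \<le> v * k - 1"
proof -
  define T where "T x = {j \<in> S. j x = w x} - {w}" for x
  have "S = (\<Union>a\<in>{..<v}. {i \<in> S. i 0 = a})"
    using letters \<open>n \<ge> 1\<close> by fastforce
  also have "card \<dots> = (\<Sum>a<v. card {i \<in> S. i 0 = a})"
    by (rule card_UN_disjoint) (use fin in auto)
  also have "\<dots> = v * k"
    using balanced \<open>n \<ge> 1\<close> by simp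
  finally have card_S: "card S = v * k" .
  have card_T: "card (T x) = k - 1" if "x < n" for x
    using balanced[OF that letters[OF \<open>w \<in> S\<close> that]] \<open>w \<in> S\<close> fin
    unfolding T_def by (subst card_Diff_singleton) auto
  have "T x \<inter> T y = {}" if "x < y" "y < n" for x y
    using agree[OF _ \<open>w \<in> S\<close> that] unfolding T_def by blast
  then have disj: "T x \<inter> T y = {}" if "x < n" "y < n" "x \<noteq> y" for x y
    using that by (metis Int_commute linorder_neqE_nat)
  have "n * (k - 1) = (\<Sum>x<n. card (T x))"
    using card_T by simp
  also have "\<dots> = card (\<Union>x\<in>{..<n}. T x)"
    by (rule card_UN_disjoint [symmetric]) (use fin disj in \<open>auto simp: T_def\<close>)
  also have "\<dots> \<le> card (S - {w})"
    by (rule card_mono) (use fin in \<open>auto simp: T_def\<close>)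
  also have "\<dots> = v * k - 1"
    using card_S \<open>w \<in> S\<close> fin by simp
  finally show ?thesis .
qed

definition cube_support :: "nat \<Rightarrow> nat \<Rightarrow> ((nat \<Rightarrow> nat) \<Rightarrow> 'a::field_char_0) \<Rightarrow> (nat \<Rightarrow> nat) set"
  where "cube_support v n C = {i \<in> index_tuples v n. C i = 1}"

lemma finite_index_tuples: "finite (index_tuples v n)"
  unfolding index_tuples_def by (intro finite_PiE) auto

lemma finite_cube_support: "finite (cube_support v n C)"
  unfolding cube_support_def using finite_index_tuples by simp

lemma cube_support_less:
  assumes "i \<in> cube_support v n C" and "x < n"
  shows "i x < v"
  using assms unfolding cube_support_def index_tuples_def by auto

context
  fixes v n :: nat and k l :: int and C :: "(nat \<Rightarrow> nat) \<Rightarrow> 'a::field_char_0"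
  assumes cube: "projection_cube v k l n C"
begin

lemma projection_entry_eq_card:
  assumes "a < v" and "b < v"
  shows "projection v n x y C $$ (a, b) =
    of_nat (card {i \<in> cube_support v n C. i x = a \<and> i y = b})"
proof -
  define F where "F = {i \<in> index_tuples v n. i x = a \<and> i y = b}"
  have "projection v n x y C $$ (a, b) = (\<Sum>i\<in>F. C i)"
    using assms by (simp add: projection_def F_def)
  also have "\<dots> = (\<Sum>i\<in>F. if C i = 1 then 1 else 0)"
    using cube by (intro sum.cong) (auto simp: projection_cube_def F_def)
  also have "\<dots> = of_nat (card {i \<in> F. C i = 1})"
    using finite_index_tuples[of v n] by (simp add: F_def flip: sum.inter_filter)
  also have "{i \<in> F. C i = 1} = {i \<in> cube_support v n C. i x = a \<and> i y = b}"
    by (auto simp: F_def cube_support_def)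
  finally show ?thesis .
qed

lemma design_projection:
  assumes "x < y" and "y < n"
  shows "symmetric_design v k l (projection v n x y C)"
  using cube assms by (simp add: projection_cube_def)

lemma card_support_two_letters:
  assumes "x < y" and "y < n" and "a < v" and "b < v"
  shows "card {i \<in> cube_support v n C. i x = a \<and> i y = b} \<in> {0, 1}"
proof -
  have "projection v n x y C $$ (a, b) \<in> elements_mat (projection v n x y C)"
    using assms by (intro elements_matI[where i = a and j = b]) (auto simp: projection_def)
  then have "projection v n x y C $$ (a, b) \<in> {0, 1}"
    using design_projection[OF assms(1,2)] by (auto simp: symmetric_design_def)
  then show ?thesis
    using assms by (simp add: projection_entry_eq_card del: card_eq_0_iff)
qed

lemma support_agree_once:
  assumes "i \<in> cube_support v n C" and "j \<in> cube_support v n C"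
    and "x < y" and "y < n" and "i x = j x" and "i y = j y"
  shows "i = j"
proof -
  define F where "F = {m \<in> cube_support v n C. m x = i x \<and> m y = i y}"
  have "card F \<le> 1"
    using card_support_two_letters[OF assms(3,4), of "i x" "i y"] cube_support_less[OF assms(1)]
      assms(3,4) unfolding F_def by auto
  moreover have "finite F" "i \<in> F" "j \<in> F"
    using assms finite_cube_support[of v n C] by (auto simp: F_def)
  ultimately show ?thesis
    by (metis card_le_Suc0_iff_eq One_nat_def)
qed

lemma card_support_letter_eq_column_sum:
  assumes "x < n"
  shows "card {i \<in> cube_support v n C. i y = b} =
    (\<Sum>a<v. card {i \<in> cube_support v n C. i x = a \<and> i y = b})"
proof -
  have "{i \<in> cube_support v n C. i y = b} =
      (\<Union>a\<in>{..<v}. {i \<in> cube_support v n C. i x = a \<and> i y = b})"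
    using cube_support_less[OF _ assms] by auto
  then show ?thesis
    using finite_cube_support[of v n C] by (simp, subst card_UN_disjoint) auto
qed

text \<open>
  A position \<open>z > 0\<close> indexes the columns of \<open>\<Pi>\<^sub>0\<^sub>z\<close>, whose sums are prescribed. Position \<open>0\<close>
  never indexes columns, so there the row sums of \<open>\<Pi>\<^sub>0\<^sub>1\<close> are needed: these are the diagonal
  entries of \<open>A A\<^sup>t\<close>, since the entries of \<open>A\<close> equal their squares.
\<close>

lemma card_support_letter:
  assumes "n \<ge> 2" and "z < n" and "c < v"
  shows "int (card {i \<in> cube_support v n C. i z = c}) = k"
proof (cases "z = 0")
  case False
  define A where "A = projection v n 0 z C"
  define M where "M a = card {i \<in> cube_support v n C. i 0 = a \<and> i z = c}" for a
  have M01: "M a \<in> {0, 1}" if "a < v" for a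
    unfolding M_def by (rule card_support_two_letters) (use False assms that in auto)
  have A_M: "A $$ (a, c) = of_nat (M a)" if "a < v" for a
    using that assms by (simp add: A_def M_def projection_entry_eq_card)
  have "card {i \<in> cube_support v n C. i z = c} = (\<Sum>a<v. M a)"
    unfolding M_def using assms by (intro card_support_letter_eq_column_sum) auto
  also have "\<dots> = (\<Sum>a<v. if A $$ (a, c) = 1 then 1 else 0)"
    using M01 A_M by (intro sum.cong) fastforce+
  also have "\<dots> = card {a. a < v \<and> A $$ (a, c) = 1}"
    by (simp flip: sum.inter_filter)
  finally show ?thesis
    using design_projection[of 0 z] False assms
    by (simp add: symmetric_design_def A_def)
next
  case True
  define A where "A = projection v n 0 1 C"
  define M where "M b = card {i \<in> cube_support v n C. i 0 = c \<and> i 1 = b}" for b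
  have M01: "M b \<in> {0, 1}" if "b < v" for b
    unfolding M_def by (rule card_support_two_letters) (use assms that in auto)
  have dim_A: "dim_row A = v" "dim_col A = v"
    by (simp_all add: A_def projection_def)
  have A_M: "A $$ (c, b) = of_nat (M b)" if "b < v" for b
    unfolding A_def M_def using that assms by (intro projection_entry_eq_card)
  have "card {i \<in> cube_support v n C. i 0 = c} = (\<Sum>b<v. M b)"
    using card_support_letter_eq_column_sum[of 1 0 c] assms by (simp add: M_def conj_commute)
  then have "of_nat (card {i \<in> cube_support v n C. i 0 = c}) = (\<Sum>b<v. of_nat (M b) :: 'a)"
    by simp
  also have "\<dots> = (\<Sum>b<v. A $$ (c, b) * A $$ (c, b))"
    using M01 A_M by (intro sum.cong) fastforce+
  also have "\<dots> = (A * transpose_mat A) $$ (c, c)"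
    using assms dim_A by (simp add: scalar_prod_def lessThan_atLeast0)
  also have "\<dots> = of_int (k - l) + of_int l"
    using design_projection[of 0 1] assms by (simp add: symmetric_design_def A_def)
  also have "\<dots> = of_int k"
    by simp
  finally have "(of_int (int (card {i \<in> cube_support v n C. i 0 = c})) :: 'a) = of_int k"
    by simp
  then show ?thesis
    using True by (simp only: of_int_eq_iff)
qed

end

theorem theorem2p8:
  fixes v n :: nat and k l :: int
  assumes "v \<ge> 1" and "n \<ge> 2" and "k \<ge> 2"
    and "\<exists>C :: (nat \<Rightarrow> nat) \<Rightarrow> 'a::field_char_0. projection_cube v k l n C"
  shows "real n \<le> real v * (real v + 1) / 2"
proof -
  obtain C :: "(nat \<Rightarrow> nat) \<Rightarrow> 'a" where C: "projection_cube v k l n C"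
    using assms(4) by blast
  define S where "S = cube_support v n C"
  have balanced: "card {i \<in> S. i x = a} = nat k" if "x < n" "a < v" for x a
    using card_support_letter[OF C \<open>n \<ge> 2\<close> that] by (simp add: S_def)
  have "card {i \<in> S. i 0 = 0} \<noteq> 0"
    using balanced[of 0 0] assms by simp
  then obtain w where "w \<in> S"
    by (metis (mono_tags, lifting) Collect_empty_eq card.empty)
  have "n * (nat k - 1) \<le> v * nat k - 1"
  proof (rule words_agreeing_once_bound)
    show "i = j" if "i \<in> S" "j \<in> S" "x < y" "y < n" "i x = j x" "i y = j y" for i j x y
      using support_agree_once[OF C] that by (simp add: S_def)
  qed (use \<open>w \<in> S\<close> balanced assms finite_cube_support cube_support_less in \<open>auto simp: S_def\<close>)
  moreover obtain m where m: "nat k = Suc (Suc m)"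
    using \<open>k \<ge> 2\<close> by (metis Suc_nat_eq_nat_zadd1 add_2_eq_Suc le_Suc_ex nat_2 nat_mono numeral_2_eq_2)
  ultimately have "n * Suc m + 1 \<le> v * Suc m + v"
    using \<open>v \<ge> 1\<close> by (simp add: algebra_simps)
  also have "\<dots> \<le> v * Suc m + (v - 1) * Suc m + 1"
    using \<open>v \<ge> 1\<close> by simp
  finally have "n * Suc m \<le> (v + (v - 1)) * Suc m"
    by (simp only: add_mult_distrib)
  then have "n \<le> v + (v - 1)"
    by (simp only: Suc_mult_le_cancel1 mult.commute[of _ "Suc m"])
  then have "real n \<le> 2 * real v - 1"
    using \<open>v \<ge> 1\<close> by linarith
  moreover have "(real v - 1) * (real v - 2) \<ge> 0"
    using \<open>v \<ge> 1\<close> by (cases "v = 1") (auto intro!: mult_nonneg_nonneg)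
  ultimately show ?thesis
    by (simp add: algebra_simps)
qed

end
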